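(* Let $g:[-1,1]\to\mathbb{R}$ be a (measurable) function with $|g(x)|\le 1$ for all $x\in[-1,1]$, let $k\in\mathbb{N}_0$, let $T_k$ be the $k$-th Chebyshev polynomial, and let $F$ be either of the two functions $$I_{\mathscr{R}}(\omega,T_k)=\int_{-1}^1 T_k(x)\cos(\omega g(x))\,dx,\qquad I_{\mathscr{I}}(\omega,T_k)=\int_{-1}^1 T_k(x)\sin(\omega g(x))\,dx .$$ Let $\omega_{\min}<\omega_{\max}$ be real numbers, let $L\in\mathbb{N}$, and let $F$ be sampled on the uniform grid of $2^L$ points $\omega_{\min}=x_0<x_1<\dots<x_{2^L-1}=\omega_{\max}$, $x_i=\omega_{\min}+hi$, $h=(\omega_{\max}-\omega_{\min})/(2^L-1)$, of the interval $[\omega_{\min},\omega_{\max}]$; denote the resulting vector by $\underline{\nu}=(F(x_i))_{i=0}^{2^L-1}\in\mathbb{R}^{2^L}$. Let $0<\varepsilon<1$. Then there exists a QTT approximation $\nu_{\mathrm{QTT}}$ of $\underline{\nu}$ whose QTT ranks are bounded by $$r(\nu_{\mathrm{QTT}})\le 1+\ln\left(\frac{8}{e-1}\right)+C(\omega_{\max}-\omega_{\min})+\ln\left(\frac1\varepsilon\right),\qquad C:=\frac14\sqrt{(e+e^{-1})^2-4}\approx 0.59,$$ and whose accuracy is $$|\underline{\nu}-\nu_{\mathrm{QTT}}|\le\varepsilon ,$$ where $|\cdot|$ denotes the maximum norm, i.e. every entry of $\underline{\nu}-\nu_{\mathrm{QTT}}$ has absolute value at most $\varepsilon$.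
   Context: Chebyshev polynomials: $T_0(x)=1$, $T_1(x)=x$, $T_{n+1}(x)=2xT_n(x)-T_{n-1}(x)$ for $n\ge 1$. TT representation: a tensor $A=[A(j_1,\dots,j_L)]$ of order $L$ with mode sizes $2$ (i.e. $j_\nu\in\{1,2\}$) is represented in the tensor train (TT) format with ranks $(r_0,\dots,r_L)$, $r_0=r_L=1$, if $$A=\sum_{\alpha_1=1}^{r_1}\cdots\sum_{\alpha_{L-1}=1}^{r_{L-1}} A^{(1)}_{1,\alpha_1}\otimes A^{(2)}_{\alpha_1,\alpha_2}\otimes\cdots\otimes A^{(L)}_{\alpha_{L-1},1}$$ with vectors $A^{(\ell)}_{\alpha_{\ell-1},\alpha_\ell}\in\mathbb{R}^2$. QTT representation: a vector $X=[X(i)]_{i=1}^{2^L}$ is folded into the order-$L$ tensor $Y$ of size $2\times\cdots\times 2$ given by $Y(j_1,\dots,j_L)=X(i)$, where $j_\nu\in\{1,2\}$ are determined by the binary representation $i-1=\sum_{\nu=1}^L (j_\nu-1)2^{\nu-1}$. A QTT representation of $X$ with ranks $(r_0,\dots,r_L)$ is a TT representation of $Y$ with these ranks. A QTT approximation $\nu_{\mathrm{QTT}}$ of $\underline{\nu}$ is a vector in $\mathbb{R}^{2^L}$ (compared with $\underline{\nu}$ entrywise) given by a QTT representation, and $r(\nu_{\mathrm{QTT}})\le R$ means that all its ranks satisfy $r_\ell\le R$. *)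

theory Defs
  imports "HOL-Analysis.Analysis"
begin

fun chebyshev_T :: "nat \<Rightarrow> real \<Rightarrow> real" where
  "chebyshev_T 0 x = 1"
| "chebyshev_T (Suc 0) x = x"
| "chebyshev_T (Suc (Suc n)) x = 2 * x * chebyshev_T (Suc n) x - chebyshev_T n x"

definition osc_integral_Re :: "(real \<Rightarrow> real) \<Rightarrow> real \<Rightarrow> (real \<Rightarrow> real) \<Rightarrow> real" where
  "osc_integral_Re g \<omega> f = (LINT x:{-1..1}|lebesgue. f x * cos (\<omega> * g x))"

definition osc_integral_Im :: "(real \<Rightarrow> real) \<Rightarrow> real \<Rightarrow> (real \<Rightarrow> real) \<Rightarrow> real" where
  "osc_integral_Im g \<omega> f = (LINT x:{-1..1}|lebesgue. f x * sin (\<omega> * g x))"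

definition grid_point :: "real \<Rightarrow> real \<Rightarrow> nat \<Rightarrow> nat \<Rightarrow> real" where
  "grid_point \<omega>min \<omega>max L i = \<omega>min + (\<omega>max - \<omega>min) / (2 ^ L - 1) * real i"

text \<open>
  A tensor of order L with all mode sizes 2 is a function on the multi-indices
  \<open>(j 1, \<dots>, j L)\<close> with entries in \<open>{1, 2}\<close>; its values elsewhere are irrelevant.
  Likewise a vector in \<open>\<real>\<^sup>2\<close> is a function whose values at 1 and 2 matter.
\<close>

definition multi_indices :: "nat \<Rightarrow> (nat \<Rightarrow> nat) set" where
  "multi_indices L = PiE {1..L} (\<lambda>_. {1, 2})"

definition elementary_tensor :: "nat \<Rightarrow> (nat \<Rightarrow> nat \<Rightarrow> real) \<Rightarrow> (nat \<Rightarrow> nat) \<Rightarrow> real" where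
  "elementary_tensor L v j = (\<Prod>\<nu>=1..L. v \<nu> (j \<nu>))"

text \<open>
  The vector \<open>A l a b\<close> is the entry with rank indices \<open>a\<close>, \<open>b\<close> of the \<open>l\<close>-th TT core.
  The summation tuple \<open>\<alpha>\<close> includes \<open>\<alpha> 0\<close> and \<open>\<alpha> L\<close>, which are both forced to be 1
  since \<open>r 0 = r L = 1\<close>.
\<close>

definition TT_representation ::
  "nat \<Rightarrow> (nat \<Rightarrow> nat) \<Rightarrow> (nat \<Rightarrow> nat \<Rightarrow> nat \<Rightarrow> nat \<Rightarrow> real) \<Rightarrow> ((nat \<Rightarrow> nat) \<Rightarrow> real) \<Rightarrow> bool" where
  "TT_representation L r A Y \<longleftrightarrow> r 0 = 1 \<and> r L = 1 \<and>
     (\<forall>j\<in>multi_indices L.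
        Y j = (\<Sum>\<alpha>\<in>PiE {0..L} (\<lambda>l. {1..r l}).
                 elementary_tensor L (\<lambda>l. A l (\<alpha> (l - 1)) (\<alpha> l)) j))"

text \<open>
  A vector in \<open>\<real>\<close> to the power \<open>2 ^ L\<close> is a function on \<open>nat\<close> of which only the values at
  \<open>0, \<dots>, 2 ^ L - 1\<close> matter. Entries are counted from 0, so the binary expansion
  yields the index itself, with no shift by 1.
\<close>

definition qtt_fold :: "nat \<Rightarrow> (nat \<Rightarrow> real) \<Rightarrow> (nat \<Rightarrow> nat) \<Rightarrow> real" where
  "qtt_fold L X j = X (\<Sum>\<nu>=1..L. (j \<nu> - 1) * 2 ^ (\<nu> - 1))"

definition QTT_representation ::
  "nat \<Rightarrow> (nat \<Rightarrow> nat) \<Rightarrow> (nat \<Rightarrow> nat \<Rightarrow> nat \<Rightarrow> nat \<Rightarrow> real) \<Rightarrow> (nat \<Rightarrow> real) \<Rightarrow> bool" where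
  "QTT_representation L r A X \<longleftrightarrow> TT_representation L r A (qtt_fold L X)"

definition rank_const :: real where
  "rank_const = 1 / 4 * sqrt ((exp 1 + inverse (exp 1)) ^ 2 - 4)"

end

theory Submission
  imports Defs "HOL-Complex_Analysis.Complex_Analysis"
begin

text \<open>
  As a function of \<open>\<omega>\<close>, the integral \<open>F\<close> extends to an entire function that grows only like
  \<open>2 cosh (Im z)\<close>, because \<open>\<bar>g\<bar> \<le> 1\<close>, \<open>\<bar>T\<^sub>k\<bar> \<le> 1\<close> and the interval of integration has
  length 2. Such a function is approximated very well by polynomials on
  \<open>[\<omega>min, \<omega>max]\<close>, and the samples of a polynomial of degree \<open>N\<close> on a uniform grid
  have a QTT representation with all ranks at most \<open>N + 1\<close>.

  For the ranks: when the binary digits are processed one after another, the partial index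
  sum \<open>s\<close> is updated to \<open>s + d\<close>, and the powers \<open>1, s, \<dots>, s\<^sup>N\<close> transform
  linearly under this shift, by the binomial theorem. So the cores need only carry the vector of
  these powers (\<open>polynomial_QTT_representation\<close>).

  For the approximation: let \<open>h\<close> be half the length of the \<open>\<omega>\<close>-interval, moved to \<open>[-1, 1]\<close>. The
  Bernstein ellipse with parameter \<open>\<rho>\<close> is the image of the circle \<open>\<bar>w\<bar> = \<rho>\<close> under
  \<open>w \<mapsto> (w + 1/w) / 2\<close>, and \<open>T\<^sub>n\<close> becomes \<open>(w\<^sup>n + w\<^sup>-\<^sup>n) / 2\<close> there. Hence Chebyshev
  coefficients are Laurent coefficients, Cauchy's inequality makes them at most
  \<open>2 M / \<rho>\<^sup>n\<close> when the function is bounded by \<open>M\<close> on the ellipse, and truncation at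
  degree \<open>N\<close> costs at most \<open>2 M / (\<rho>\<^sup>N (\<rho> - 1))\<close> (\<open>chebyshev_truncation\<close>). Here
  \<open>M = 2 cosh (h (\<rho> - 1/\<rho>) / 2)\<close>. To stay with polynomials, the entire function is first
  replaced by a long Taylor polynomial, at an error as small as desired
  (\<open>osc_integral_poly_approx\<close>).

  The degree \<open>N\<close> must be an integer, and rounding the allowed rank down loses up to a factor
  \<open>e\<close> in the error. With \<open>\<rho> = e\<close> this loss is compensated when
  \<open>y = h (e - 1/e) / 2 = rank_const (\<omega>max - \<omega>min)\<close> is at least \<open>1/2\<close>, since then
  \<open>cosh y\<close> is close enough to \<open>e\<^sup>y / 2\<close>. For smaller \<open>y\<close> the larger ellipse \<open>\<rho> = 4\<close> does the job
  (\<open>exists_good_ellipse\<close>).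
\<close>

section \<open>QTT representation of sampled polynomials\<close>

text \<open>Summing over the last rank index first is one step of evaluating the tensor train from
  right to left; \<open>w\<close> stands for the part that has already been contracted.\<close>

lemma TT_sum_step:
  fixes B :: "nat \<Rightarrow> nat \<Rightarrow> nat \<Rightarrow> real" and w :: "nat \<Rightarrow> real" and R :: "nat \<Rightarrow> nat set"
  shows "(\<Sum>\<alpha>\<in>PiE {0..Suc l} R. (\<Prod>\<nu>=1..Suc l. B \<nu> (\<alpha> (\<nu> - 1)) (\<alpha> \<nu>)) * w (\<alpha> (Suc l))) =
         (\<Sum>\<alpha>\<in>PiE {0..l} R. (\<Prod>\<nu>=1..l. B \<nu> (\<alpha> (\<nu> - 1)) (\<alpha> \<nu>)) *
            (\<Sum>b\<in>R (Suc l). B (Suc l) (\<alpha> l) b * w b))"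
proof -
  let ?f = "\<lambda>\<alpha>. (\<Prod>\<nu>=1..Suc l. B \<nu> (\<alpha> (\<nu> - 1)) (\<alpha> \<nu>)) * w (\<alpha> (Suc l))"
  let ?u = "\<lambda>(b, \<alpha>). \<alpha>(Suc l := b)"
  have eq: "PiE {0..Suc l} R = ?u ` (R (Suc l) \<times> PiE {0..l} R)"
    by (simp add: atLeast0_atMost_Suc PiE_insert_eq)
  have inj: "inj_on ?u (R (Suc l) \<times> PiE {0..l} R)"
    using inj_combinator[of "Suc l" "{0..l}" R] by (simp add: case_prod_unfold)
  have upd: "?f (\<alpha>(Suc l := b)) =
      (\<Prod>\<nu>=1..l. B \<nu> (\<alpha> (\<nu> - 1)) (\<alpha> \<nu>)) * (B (Suc l) (\<alpha> l) b * w b)" for b \<alpha>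
  proof -
    have "(\<Prod>\<nu>=1..l. B \<nu> ((\<alpha>(Suc l := b)) (\<nu> - 1)) ((\<alpha>(Suc l := b)) \<nu>)) =
        (\<Prod>\<nu>=1..l. B \<nu> (\<alpha> (\<nu> - 1)) (\<alpha> \<nu>))"
      by (rule prod.cong) auto
    then show ?thesis by (simp add: mult.assoc)
  qed
  have "sum ?f (PiE {0..Suc l} R) = (\<Sum>(b, \<alpha>)\<in>R (Suc l) \<times> PiE {0..l} R. ?f (\<alpha>(Suc l := b)))"
    unfolding eq by (subst sum.reindex[OF inj]) (simp add: case_prod_unfold comp_def)
  also have "\<dots> = (\<Sum>b\<in>R (Suc l). \<Sum>\<alpha>\<in>PiE {0..l} R. ?f (\<alpha>(Suc l := b)))"
    by (rule sum.cartesian_product[symmetric])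
  also have "\<dots> = (\<Sum>\<alpha>\<in>PiE {0..l} R. \<Sum>b\<in>R (Suc l). ?f (\<alpha>(Suc l := b)))"
    by (rule sum.swap)
  finally show ?thesis
    by (simp only: upd sum_distrib_left)
qed

text \<open>A tensor train is a product of matrices, so it can be evaluated by a row vector \<open>v\<close> that
  travels from left to right. The free weight \<open>w\<close> makes the induction on the number of cores
  work.\<close>

lemma TT_sum_eq_transfer:
  fixes B :: "nat \<Rightarrow> nat \<Rightarrow> nat \<Rightarrow> real" and v :: "nat \<Rightarrow> nat \<Rightarrow> real"
  assumes "r 0 = 1" and v0: "v 0 1 = 1"
    and step: "\<And>l b. l < n \<Longrightarrow> b \<in> {1..r (Suc l)} \<Longrightarrow>
                 (\<Sum>a=1..r l. v l a * B (Suc l) a b) = v (Suc l) b"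
  shows "(\<Sum>\<alpha>\<in>PiE {0..n} (\<lambda>l. {1..r l}). (\<Prod>\<nu>=1..n. B \<nu> (\<alpha> (\<nu> - 1)) (\<alpha> \<nu>)) * w (\<alpha> n)) =
         (\<Sum>b=1..r n. v n b * w b)"
  using step
proof (induction n arbitrary: w)
  case 0
  have "PiE {0..0::nat} (\<lambda>l. {1..r l}) = {\<lambda>x\<in>{0}. 1}"
    using assms(1) by (auto simp: PiE_def extensional_def Pi_def fun_eq_iff)
  then show ?case using assms(1) v0 by simp
next
  case (Suc n)
  have "(\<Sum>\<alpha>\<in>PiE {0..Suc n} (\<lambda>l. {1..r l}).
          (\<Prod>\<nu>=1..Suc n. B \<nu> (\<alpha> (\<nu> - 1)) (\<alpha> \<nu>)) * w (\<alpha> (Suc n))) =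
        (\<Sum>\<alpha>\<in>PiE {0..n} (\<lambda>l. {1..r l}). (\<Prod>\<nu>=1..n. B \<nu> (\<alpha> (\<nu> - 1)) (\<alpha> \<nu>)) *
          (\<Sum>b=1..r (Suc n). B (Suc n) (\<alpha> n) b * w b))"
    by (rule TT_sum_step)
  also have "\<dots> = (\<Sum>a=1..r n. v n a * (\<Sum>b=1..r (Suc n). B (Suc n) a b * w b))"
    by (rule Suc.IH) (rule Suc.prems, simp_all)
  also have "\<dots> = (\<Sum>a=1..r n. \<Sum>b=1..r (Suc n). v n a * B (Suc n) a b * w b)"
    by (simp add: sum_distrib_left mult.assoc)
  also have "\<dots> = (\<Sum>b=1..r (Suc n). \<Sum>a=1..r n. v n a * B (Suc n) a b * w b)"
    by (rule sum.swap)
  also have "\<dots> = (\<Sum>b=1..r (Suc n). v (Suc n) b * w b)"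
    by (rule sum.cong) (simp_all only: Suc.prems[OF lessI] flip: sum_distrib_right)
  finally show ?case .
qed

lemma binomial_shifted_sum:
  fixes s b :: real
  assumes "n \<le> N"
  shows "(\<Sum>a=1..N + 1. s ^ (a - 1) * (real (n choose (a - 1)) * b ^ (n - (a - 1)))) = (s + b) ^ n"
proof -
  have "(\<Sum>a=1..N + 1. s ^ (a - 1) * (real (n choose (a - 1)) * b ^ (n - (a - 1)))) =
      (\<Sum>a\<le>N. s ^ a * (real (n choose a) * b ^ (n - a)))"
    by (rule sum.reindex_bij_witness[of _ Suc "\<lambda>a. a - 1"]) auto
  also have "\<dots> = (\<Sum>a\<le>n. s ^ a * (real (n choose a) * b ^ (n - a)))"
    by (rule sum.mono_neutral_right) (use assms in auto)
  also have "\<dots> = (s + b) ^ n"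
    by (simp add: binomial_ring mult_ac)
  finally show ?thesis .
qed

text \<open>The row vector after \<open>l < L\<close> cores consists of the powers \<open>0, \<dots>, N\<close> of the partial index
  sum \<open>s l\<close>, and the binomial coefficients are the matrix of the shift by the next digit. The
  last core shifts and applies the coefficients of \<open>P\<close> at once.\<close>

lemma polynomial_QTT_representation:
  fixes P :: "real poly"
  assumes L: "L \<ge> 1" and deg: "degree P \<le> N"
  shows "\<exists>A. QTT_representation L (\<lambda>l. if l = 0 \<or> l = L then 1 else N + 1) A (\<lambda>i. poly P (real i))"
proof -
  define r where "r = (\<lambda>l. if l = 0 \<or> l = L then 1 else N + 1)"
  define d where "d = (\<lambda>l j :: nat. real ((j - 1) * 2 ^ (l - 1)))"
  define A where "A = (\<lambda>l a b j. if l = L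
      then \<Sum>n\<le>N. coeff P n * (real (n choose (a - 1)) * d l j ^ (n - (a - 1)))
      else real ((b - 1) choose (a - 1)) * d l j ^ ((b - 1) - (a - 1)))"
  have polyP: "poly P x = (\<Sum>n\<le>N. coeff P n * x ^ n)" for x
    unfolding poly_altdef
    by (rule sum.mono_neutral_left) (use deg in \<open>auto simp: coeff_eq_0\<close>)
  have "QTT_representation L r A (\<lambda>i. poly P (real i))"
    unfolding QTT_representation_def TT_representation_def
  proof (intro conjI ballI)
    fix j
    define s where "s = (\<lambda>l. \<Sum>\<nu>=1..l. d \<nu> (j \<nu>))"
    define v where "v = (\<lambda>l b. if l = L then poly P (s L) else s l ^ (b - 1))"
    have v0: "v 0 1 = 1" using L by (simp add: v_def)
    have s_Suc: "s (Suc l) = s l + d (Suc l) (j (Suc l))" for l by (simp add: s_def)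
    have step: "(\<Sum>a=1..r l. v l a * A (Suc l) a b (j (Suc l))) = v (Suc l) b"
      if l: "l < L" and b: "b \<in> {1..r (Suc l)}" for l b
    proof -
      let ?d = "d (Suc l) (j (Suc l))"
      have bin: "(\<Sum>a=1..r l. s l ^ (a - 1) * (real (n choose (a - 1)) * ?d ^ (n - (a - 1)))) =
          s (Suc l) ^ n" if "n \<le> N" for n
      proof (cases "l = 0")
        \<comment> \<open>The first core has only one row, but \<open>s 0 = 0\<close> has no nonzero power except the zeroth.\<close>
        case True
        then show ?thesis using L by (simp add: r_def s_def)
      next
        case False
        then show ?thesis using binomial_shifted_sum[OF that] l by (simp add: r_def s_Suc)
      qed
      show ?thesis
      proof (cases "Suc l = L")
        case True
        have "(\<Sum>a=1..r l. v l a * A (Suc l) a b (j (Suc l))) =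
            (\<Sum>a=1..r l. \<Sum>n\<le>N. coeff P n * (s l ^ (a - 1) * (real (n choose (a - 1)) * ?d ^ (n - (a - 1)))))"
          using True by (simp add: v_def A_def sum_distrib_left mult_ac)
        also have "\<dots> = (\<Sum>n\<le>N. \<Sum>a=1..r l. coeff P n * (s l ^ (a - 1) * (real (n choose (a - 1)) * ?d ^ (n - (a - 1)))))"
          by (rule sum.swap)
        also have "\<dots> = (\<Sum>n\<le>N. coeff P n * s (Suc l) ^ n)"
          by (rule sum.cong) (simp_all only: bin atMost_iff flip: sum_distrib_left)
        finally show ?thesis using True by (simp add: v_def polyP)
      next
        case False
        then have "b - 1 \<le> N" using b l by (auto simp: r_def)
        from bin[OF this] show ?thesis using False l by (simp add: v_def A_def)
      qed
    qed
    have "(\<Sum>\<alpha>\<in>PiE {0..L} (\<lambda>l. {1..r l}). (\<Prod>\<nu>=1..L. A \<nu> (\<alpha> (\<nu> - 1)) (\<alpha> \<nu>) (j \<nu>)) * 1) =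
        (\<Sum>b=1..r L. v L b * 1)"
      by (rule TT_sum_eq_transfer[where B = "\<lambda>\<nu> a b. A \<nu> a b (j \<nu>)" and w = "\<lambda>_. 1"])
        (use v0 step in \<open>auto simp: r_def\<close>)
    moreover have "qtt_fold L (\<lambda>i. poly P (real i)) j = poly P (s L)"
      by (simp add: qtt_fold_def s_def d_def)
    ultimately show "qtt_fold L (\<lambda>i. poly P (real i)) j =
        (\<Sum>\<alpha>\<in>PiE {0..L} (\<lambda>l. {1..r l}). elementary_tensor L (\<lambda>l. A l (\<alpha> (l - 1)) (\<alpha> l)) j)"
      by (simp add: elementary_tensor_def v_def r_def)
  qed (simp_all add: r_def)
  then show ?thesis unfolding r_def by blast
qed

section \<open>Truncation of Chebyshev expansions\<close>

lemma poly_coeff_Cauchy: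
  fixes H :: "complex poly"
  assumes "\<rho> > 0" and "\<And>w. norm w = \<rho> \<Longrightarrow> norm (poly H w) \<le> B"
  shows "norm (coeff H n) \<le> B / \<rho> ^ n"
proof -
  have hd: "(deriv ^^ m) (poly H) = poly ((pderiv ^^ m) H)" for m
  proof (induction m)
    case (Suc m)
    have "deriv (poly p) = poly (pderiv p)" for p :: "complex poly"
      by (rule ext, rule DERIV_imp_deriv) (rule poly_DERIV)
    with Suc show ?case by simp
  qed simp
  have "norm ((deriv ^^ n) (poly H) 0) \<le> fact n * B / \<rho> ^ n"
    by (rule Cauchy_inequality)
      (use assms in \<open>auto intro!: holomorphic_intros continuous_intros\<close>)
  moreover have "(deriv ^^ n) (poly H) 0 = fact n * coeff H n"
    by (simp add: hd poly_0_coeff_0 coeff_higher_pderiv pochhammer_fact[symmetric])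
  ultimately have "fact n * norm (coeff H n) \<le> fact n * (B / \<rho> ^ n)"
    by (simp add: norm_mult)
  then show ?thesis
    by (simp only: mult_le_cancel_left_pos[OF fact_gt_zero])
qed

text \<open>Coefficients are complex, since the polynomials are evaluated on an ellipse around
  \<open>[-1, 1]\<close>.\<close>

fun chebyshev_poly :: "nat \<Rightarrow> complex poly" where
  "chebyshev_poly 0 = 1"
| "chebyshev_poly (Suc 0) = [:0, 1:]"
| "chebyshev_poly (Suc (Suc n)) = [:0, 2:] * chebyshev_poly (Suc n) - chebyshev_poly n"

lemma chebyshev_poly_of_real: "poly (chebyshev_poly n) (of_real t) = of_real (chebyshev_T n t)"
  by (induction n t rule: chebyshev_T.induct) simp_all

lemma chebyshev_T_cos: "chebyshev_T n (cos \<theta>) = cos (real n * \<theta>)"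
proof (induction n "cos \<theta>" rule: chebyshev_T.induct)
  case (3 n)
  have "cos (real (Suc (Suc n)) * \<theta>) + cos (real n * \<theta>) = 2 * cos \<theta> * cos (real (Suc n) * \<theta>)"
    using cos_add[of "real (Suc n) * \<theta>" \<theta>] cos_diff[of "real (Suc n) * \<theta>" \<theta>]
    by (simp add: algebra_simps)
  with 3 show ?case by simp
qed simp_all

lemma abs_chebyshev_T_le_1:
  assumes "\<bar>t\<bar> \<le> 1"
  shows "\<bar>chebyshev_T n t\<bar> \<le> 1"
  using chebyshev_T_cos[of n "arccos t"] assms by (simp add: cos_arccos_abs)

text \<open>With \<open>w = exp (\<i> \<theta>)\<close> this is \<open>T\<^sub>n (cos \<theta>) = cos (n \<theta>)\<close>. It turns Chebyshev expansions on an
  ellipse into symmetric Laurent polynomials on a circle.\<close>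

lemma chebyshev_poly_Joukowski:
  assumes "w \<noteq> 0"
  shows "poly (chebyshev_poly n) ((w + inverse w) / 2) = (w ^ n + inverse w ^ n) / 2"
proof (induction n rule: chebyshev_poly.induct)
  case (3 n)
  let ?v = "inverse w"
  have red: "w * ?v ^ Suc n = ?v ^ n" "?v * w ^ Suc n = w ^ n"
    using assms by simp_all
  have "(w + ?v) * (w ^ Suc n + ?v ^ Suc n) =
      w ^ Suc (Suc n) + ?v ^ Suc (Suc n) + w * ?v ^ Suc n + ?v * w ^ Suc n"
    by (simp add: algebra_simps)
  then have "(w + ?v) * ((w ^ Suc n + ?v ^ Suc n) / 2) - (w ^ n + ?v ^ n) / 2 =
      (w ^ Suc (Suc n) + ?v ^ Suc (Suc n)) / 2"
    unfolding red by (simp add: field_simps)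
  moreover have "poly (chebyshev_poly (Suc (Suc n))) ((w + ?v) / 2) =
      (w + ?v) * poly (chebyshev_poly (Suc n)) ((w + ?v) / 2) - poly (chebyshev_poly n) ((w + ?v) / 2)"
    by simp
  ultimately show ?case by (simp only: 3)
qed simp_all

lemma degree_chebyshev_poly: "degree (chebyshev_poly n) \<le> n"
proof (induction n rule: chebyshev_poly.induct)
  case (3 n)
  have "degree ([:0, 2:] * chebyshev_poly (Suc n)) \<le> 1 + Suc n"
    using 3(1) by (intro order_trans[OF degree_mult_le] add_mono) auto
  then show ?case using 3(2) by (auto intro!: degree_diff_le)
qed simp_all

lemma lead_coeff_chebyshev_poly: "coeff (chebyshev_poly n) n \<noteq> 0"
proof (induction n rule: chebyshev_poly.induct)
  case (3 n)
  have "coeff (chebyshev_poly n) (Suc (Suc n)) = 0"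
    using degree_chebyshev_poly[of n] by (intro coeff_eq_0) simp
  then show ?case using 3 by simp
qed simp_all

lemma chebyshev_expansion:
  fixes q :: "complex poly"
  assumes "degree q \<le> K"
  shows "\<exists>c. q = (\<Sum>n\<le>K. smult (c n) (chebyshev_poly n))"
  using assms
proof (induction K arbitrary: q)
  case 0
  then obtain a where "q = [:a:]" by (auto elim: degree_eq_zeroE)
  then show ?case by (intro exI[of _ "\<lambda>_. a"]) simp
next
  case (Suc K)
  define a where "a = coeff q (Suc K) / coeff (chebyshev_poly (Suc K)) (Suc K)"
  let ?q = "q - smult a (chebyshev_poly (Suc K))"
  have "degree ?q \<le> Suc K"
    using Suc.prems degree_chebyshev_poly[of "Suc K"]
    by (intro degree_diff_le order_trans[OF degree_smult_le])
  moreover have "coeff ?q (Suc K) = 0"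
    using lead_coeff_chebyshev_poly[of "Suc K"] by (simp add: a_def)
  ultimately have "degree ?q \<le> K"
    by (metis Suc_leI antisym degree_0 leading_coeff_0_iff linorder_le_cases not_less_eq_eq zero_le)
  then obtain c where c: "?q = (\<Sum>n\<le>K. smult (c n) (chebyshev_poly n))"
    using Suc.IH by blast
  have "q = (\<Sum>n\<le>Suc K. smult ((c(Suc K := a)) n) (chebyshev_poly n))"
    using c by (simp add: algebra_simps)
  then show ?case by blast
qed

lemma geometric_tail:
  fixes \<rho> :: real
  assumes "\<rho> > 1" "N \<le> K"
  shows "(\<Sum>n\<in>{N<..K}. 1 / \<rho> ^ n) \<le> 1 / (\<rho> ^ N * (\<rho> - 1))"
proof -
  have "(\<Sum>n\<in>{N<..K}. 1 / \<rho> ^ n) = (1 / \<rho> ^ N - 1 / \<rho> ^ K) / (\<rho> - 1)"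
    using assms(2)
  proof (induction K rule: dec_induct)
    case (step K)
    then have "{N<..Suc K} = insert (Suc K) {N<..K}" by auto
    then have "(\<Sum>n\<in>{N<..Suc K}. 1 / \<rho> ^ n) = 1 / \<rho> ^ Suc K + (1 / \<rho> ^ N - 1 / \<rho> ^ K) / (\<rho> - 1)"
      using step.IH by simp
    also have "\<dots> = (1 / \<rho> ^ N - 1 / \<rho> ^ Suc K) / (\<rho> - 1)"
      using assms(1) by (simp add: field_simps)
    finally show ?case .
  qed simp
  also have "\<dots> \<le> (1 / \<rho> ^ N) / (\<rho> - 1)"
    using assms(1) by (intro divide_right_mono) auto
  finally show ?thesis by simp
qed

text \<open>Bernstein's estimate. The substitution \<open>z = (w + 1/w) / 2\<close> makes \<open>q\<close> a Laurent polynomial in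
  \<open>w\<close> whose coefficient at \<open>w\<^sup>n\<close>, \<open>n \<ge> 1\<close>, is half the Chebyshev coefficient \<open>c n\<close>; so Cauchy's inequality
  on \<open>\<bar>w\<bar> = \<rho>\<close> gives \<open>\<bar>c n\<bar> \<le> 2 M / \<rho>\<^sup>n\<close>, and the discarded part is bounded by a geometric
  series because \<open>\<bar>T\<^sub>n\<bar> \<le> 1\<close> on \<open>[-1, 1]\<close>.\<close>

lemma chebyshev_truncation:
  fixes q :: "complex poly"
  assumes \<rho>: "\<rho> > 1"
    and M: "\<And>w. norm w = \<rho> \<Longrightarrow> norm (poly q ((w + inverse w) / 2)) \<le> M"
  shows "\<exists>p. degree p \<le> N \<and>
           (\<forall>t::real. \<bar>t\<bar> \<le> 1 \<longrightarrow> norm (poly q (of_real t) - poly p (of_real t)) \<le> 2 * M / (\<rho> ^ N * (\<rho> - 1)))"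
proof -
  define K where "K = max N (degree q)"
  have NK: "N \<le> K" by (simp add: K_def)
  obtain c where c: "q = (\<Sum>n\<le>K. smult (c n) (chebyshev_poly n))"
    using chebyshev_expansion[of q K] by (auto simp: K_def)
  \<comment> \<open>The factor \<open>w\<^sup>K\<close> clears the denominators of the Laurent polynomial.\<close>
  define H where "H = (\<Sum>n\<le>K. smult (c n / 2) (monom 1 (K + n) + monom 1 (K - n)))"
  have H: "poly H w = w ^ K * poly q ((w + inverse w) / 2)" if "w \<noteq> 0" for w
  proof -
    have "w ^ (K - n) = w ^ K * inverse w ^ n" if "n \<le> K" for n
      using \<open>w \<noteq> 0\<close> that by (simp add: power_diff field_simps)
    then have "poly H w = (\<Sum>n\<le>K. w ^ K * (c n * ((w ^ n + inverse w ^ n) / 2)))"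
      unfolding H_def poly_sum
      by (intro sum.cong) (auto simp: poly_monom power_add algebra_simps)
    also have "\<dots> = w ^ K * poly q ((w + inverse w) / 2)"
      unfolding c poly_sum by (simp add: chebyshev_poly_Joukowski that sum_distrib_left)
    finally show ?thesis .
  qed
  have cn: "norm (c n) \<le> 2 * M * (1 / \<rho> ^ n)" if n: "n > 0" "n \<le> K" for n
  proof -
    have "norm (poly H w) \<le> \<rho> ^ K * M" if "norm w = \<rho>" for w
    proof -
      have "w \<noteq> 0" using that \<rho> by auto
      then show ?thesis using M[OF that] \<rho> that by (simp add: H norm_mult norm_power)
    qed
    then have "norm (coeff H (K + n)) \<le> \<rho> ^ K * M / \<rho> ^ (K + n)"
      using \<rho> by (intro poly_coeff_Cauchy) auto
    moreover have "coeff H (K + n) = (\<Sum>m\<le>K. if m = n then c n / 2 else 0)"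
      unfolding H_def coeff_sum using n by (intro sum.cong) auto
    ultimately show ?thesis using n \<rho> by (simp add: norm_divide power_add field_simps)
  qed
  have M0: "M \<ge> 0" using M[of "of_real \<rho>"] \<rho> by (simp add: order_trans[OF norm_ge_zero])
  define p where "p = (\<Sum>n\<le>N. smult (c n) (chebyshev_poly n))"
  have "degree p \<le> N"
    unfolding p_def
    by (intro degree_sum_le order_trans[OF degree_smult_le] order_trans[OF degree_chebyshev_poly]) auto
  moreover have "norm (poly q (of_real t) - poly p (of_real t)) \<le> 2 * M / (\<rho> ^ N * (\<rho> - 1))"
    if t: "\<bar>t\<bar> \<le> 1" for t
  proof -
    have "{..K} = {..N} \<union> {N<..K}" using NK by auto
    then have "q = p + (\<Sum>n\<in>{N<..K}. smult (c n) (chebyshev_poly n))"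
      unfolding c p_def by (subst \<open>{..K} = _\<close>, subst sum.union_disjoint) auto
    then have "poly q (of_real t) - poly p (of_real t) = (\<Sum>n\<in>{N<..K}. c n * of_real (chebyshev_T n t))"
      by (simp add: poly_sum chebyshev_poly_of_real)
    also have "norm \<dots> \<le> (\<Sum>n\<in>{N<..K}. 2 * M * (1 / \<rho> ^ n))"
    proof (rule sum_norm_le)
      fix n assume n: "n \<in> {N<..K}"
      have "norm (c n * of_real (chebyshev_T n t)) \<le> norm (c n)"
        using mult_left_mono[OF abs_chebyshev_T_le_1[OF t] norm_ge_zero] by (simp add: norm_mult)
      also have "\<dots> \<le> 2 * M * (1 / \<rho> ^ n)" using cn[of n] n by auto
      finally show "norm (c n * of_real (chebyshev_T n t)) \<le> 2 * M * (1 / \<rho> ^ n)" .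
    qed
    also have "\<dots> = 2 * M * (\<Sum>n\<in>{N<..K}. 1 / \<rho> ^ n)" by (simp only: sum_distrib_left)
    also have "\<dots> \<le> 2 * M * (1 / (\<rho> ^ N * (\<rho> - 1)))"
      using geometric_tail[OF \<rho> NK] M0 by (intro mult_left_mono) auto
    finally show ?thesis by simp
  qed
  ultimately show ?thesis by blast
qed

section \<open>The oscillatory integrals as entire functions\<close>

lemma continuous_on_chebyshev_T: "continuous_on S (chebyshev_T n)"
proof (induction n rule: induct_nat_012)
  case 0
  show ?case by simp
next
  case 1
  show ?case by simp
next
  case (ge2 n)
  have "chebyshev_T (Suc (Suc n)) = (\<lambda>x. 2 * x * chebyshev_T (Suc n) x - chebyshev_T n x)"
    by auto
  then show ?case using ge2 by (auto intro!: continuous_intros)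
qed

lemma cosh_le_cosh_of_abs_le:
  fixes x y :: real
  assumes "\<bar>x\<bar> \<le> y"
  shows "cosh x \<le> cosh y"
  using cosh_real_nonneg_le_iff[of "\<bar>x\<bar>" y] assms by (simp add: cosh_real_abs)

text \<open>The hyperbolic cosine is sharper here than \<open>exp \<bar>Im z\<bar>\<close>: the factor 2 that it
  gains for large \<open>\<bar>Im z\<bar>\<close> pays for the rounding of the degree in \<open>exists_good_ellipse\<close>.\<close>

lemma norm_sin_cos_le_cosh:
  fixes z :: complex
  shows "norm (cos z) \<le> cosh (Im z)" "norm (sin z) \<le> cosh (Im z)"
proof -
  have e: "norm (exp (\<i> * z)) + norm (exp (- (\<i> * z))) = 2 * cosh (Im z)"
    by (simp add: cosh_field_def)
  have "norm (cos z) = norm (exp (\<i> * z) + exp (- (\<i> * z))) / 2"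
    by (simp add: cos_exp_eq norm_divide)
  also have "\<dots> \<le> cosh (Im z)"
    using norm_triangle_ineq[of "exp (\<i> * z)" "exp (- (\<i> * z))"] e by simp
  finally show "norm (cos z) \<le> cosh (Im z)" .
  have "norm (sin z) = norm (exp (\<i> * z) - exp (- (\<i> * z))) / 2"
    by (simp add: sin_exp_eq norm_divide norm_mult)
  also have "\<dots> \<le> cosh (Im z)"
    using norm_triangle_ineq4[of "exp (\<i> * z)" "exp (- (\<i> * z))"] e by simp
  finally show "norm (sin z) \<le> cosh (Im z)" .
qed

lemma power_series_uniform_approx:
  fixes \<phi> :: "complex \<Rightarrow> complex" and a :: "nat \<Rightarrow> real"
  assumes sums: "\<And>z. (\<lambda>m. a m *\<^sub>R z ^ m) sums \<phi> z"
    and abs: "summable (\<lambda>m. norm (a m *\<^sub>R of_real R ^ m :: complex))"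
    and "\<eta> > 0"
  shows "\<exists>K. \<forall>z. norm z \<le> R \<longrightarrow> norm (\<phi> z - (\<Sum>m<K. of_real (a m) * z ^ m)) \<le> \<eta>"
proof -
  have "uniform_limit (cball 0 R) (\<lambda>n z. \<Sum>m<n. a m *\<^sub>R z ^ m)
      (\<lambda>z :: complex. \<Sum>m. a m *\<^sub>R z ^ m) sequentially"
  proof (rule Weierstrass_m_test[where M = "\<lambda>m. norm (a m *\<^sub>R of_real R ^ m :: complex)"])
    fix m and z :: complex assume "z \<in> cball 0 R"
    then have "norm z ^ m \<le> \<bar>R\<bar> ^ m" by (intro power_mono) auto
    then show "norm (a m *\<^sub>R z ^ m) \<le> norm (a m *\<^sub>R of_real R ^ m :: complex)"
      by (simp add: norm_power mult_left_mono)
  qed (rule abs)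
  then have "uniform_limit (cball 0 R) (\<lambda>n z. \<Sum>m<n. a m *\<^sub>R z ^ m) \<phi> sequentially"
    using sums by (simp add: sums_iff)
  from uniform_limitD[OF this \<open>\<eta> > 0\<close>] obtain K
    where "\<forall>z\<in>cball 0 R. dist (\<Sum>m<K. a m *\<^sub>R z ^ m) (\<phi> z) < \<eta>"
    by (auto simp: eventually_sequentially)
  then show ?thesis
    by (intro exI[of _ K])
      (auto simp: dist_norm norm_minus_commute scaleR_conv_of_real less_imp_le)
qed

text \<open>Both integrals are treated at once: \<open>\<phi>\<close> is the complex cosine or sine with Taylor
  coefficients \<open>a m\<close>, and \<open>\<psi>\<close> is its real counterpart. Integrating \<open>T\<^sub>k (x)\<close> times a Taylor
  polynomial of \<open>\<phi> (g x * z)\<close> over \<open>x\<close> gives a polynomial in \<open>z\<close>, with moments of \<open>g\<close> in its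
  coefficients. It inherits the bound of \<open>\<phi>\<close> and the closeness to \<open>\<phi>\<close>, because
  \<open>\<bar>g x * z\<bar> \<le> \<bar>z\<bar>\<close> and \<open>\<bar>T\<^sub>k\<bar> \<le> 1\<close>; the factor 2 is the length of \<open>[-1, 1]\<close>.\<close>

lemma osc_integral_poly_approx:
  fixes g \<psi> :: "real \<Rightarrow> real" and \<phi> :: "complex \<Rightarrow> complex" and a :: "nat \<Rightarrow> real"
  assumes g: "g \<in> borel_measurable (lebesgue_on {-1..1})"
    and g1: "\<And>x. x \<in> {-1..1} \<Longrightarrow> \<bar>g x\<bar> \<le> 1"
    and sums: "\<And>z. (\<lambda>m. a m *\<^sub>R z ^ m) sums \<phi> z"
    and abs: "\<And>R. summable (\<lambda>m. norm (a m *\<^sub>R of_real R ^ m :: complex))"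
    and \<phi>: "\<And>z. norm (\<phi> z) \<le> cosh (Im z)"
    and \<psi>: "\<And>x. of_real (\<psi> x) = \<phi> (of_real x)" "continuous_on UNIV \<psi>"
    and \<eta>: "\<eta> > 0"
  shows "\<exists>q :: complex poly. \<forall>z. norm z \<le> R \<longrightarrow>
           norm (poly q z) \<le> 2 * (cosh (Im z) + \<eta>) \<and>
           (Im z = 0 \<longrightarrow> norm (of_real (LINT x:{-1..1}|lebesgue. chebyshev_T k x * \<psi> (Re z * g x)) - poly q z) \<le> 2 * \<eta>)"
proof -
  define M where "M = lebesgue_on {-1..1::real}"
  interpret finite_measure M
    unfolding M_def by (rule finite_measure_lebesgue_on) simp
  have sp: "space M = {-1..1}" by (simp add: M_def)
  have meas: "measure M (space M) = 2" by (simp add: M_def measure_restrict_space)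
  have gM [measurable]: "g \<in> borel_measurable M" using g by (simp add: M_def)
  have T [measurable]: "chebyshev_T k \<in> borel_measurable M"
    unfolding M_def
    by (intro continuous_imp_measurable_on_sets_lebesgue continuous_on_chebyshev_T) simp
  have T1: "\<bar>chebyshev_T k x\<bar> \<le> 1" if "x \<in> space M" for x
    using that by (intro abs_chebyshev_T_le_1) (auto simp: sp)
  have g1': "\<bar>g x\<bar> \<le> 1" if "x \<in> space M" for x using g1 that by (simp add: sp)
  have bound: "norm (LINT x|M. u x) \<le> 2 * B"
    if "\<And>x. x \<in> space M \<Longrightarrow> norm (u x) \<le> B" "B \<ge> 0" for u :: "real \<Rightarrow> complex" and B
  proof (cases "integrable M u")
    case True
    have "norm (LINT x|M. u x) \<le> (LINT x|M. norm (u x))" by (rule integral_norm_bound)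
    also have "\<dots> \<le> (LINT x|M. B)"
      by (rule integral_mono) (use True that in auto)
    finally show ?thesis by (simp add: meas)
  qed (use that in \<open>simp add: not_integrable_integral_eq\<close>)
  obtain K where K: "\<And>z. norm z \<le> R \<Longrightarrow> norm (\<phi> z - (\<Sum>m<K. of_real (a m) * z ^ m)) \<le> \<eta>"
    using power_series_uniform_approx[OF sums abs \<eta>] by metis
  define S where "S = (\<lambda>z. \<Sum>m<K. complex_of_real (a m) * z ^ m)"
  define \<mu> where "\<mu> = (\<lambda>m. LINT x|M. complex_of_real (chebyshev_T k x * g x ^ m))"
  have int: "integrable M (\<lambda>x. complex_of_real (chebyshev_T k x * g x ^ m))" for m
  proof (rule integrable_const_bound[of _ 1])
    show "AE x in M. norm (complex_of_real (chebyshev_T k x * g x ^ m)) \<le> 1"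
      using T1 g1' by (intro AE_I2) (auto simp: norm_mult norm_power intro!: mult_le_one power_le_one)
  qed measurable
  define q where "q = (\<Sum>m<K. monom (of_real (a m) * \<mu> m) m)"
  have q: "poly q z = (LINT x|M. of_real (chebyshev_T k x) * S (of_real (g x) * z))"
    and qint: "integrable M (\<lambda>x. of_real (chebyshev_T k x) * S (of_real (g x) * z))" for z
  proof -
    have S: "of_real (chebyshev_T k x) * S (of_real (g x) * z) =
        (\<Sum>m<K. of_real (a m) * z ^ m * complex_of_real (chebyshev_T k x * g x ^ m))" for x
      by (simp add: S_def sum_distrib_left power_mult_distrib mult_ac)
    show "integrable M (\<lambda>x. of_real (chebyshev_T k x) * S (of_real (g x) * z))"
      unfolding S by (intro Bochner_Integration.integrable_sum integrable_mult_right int)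
    show "poly q z = (LINT x|M. of_real (chebyshev_T k x) * S (of_real (g x) * z))"
      unfolding S
      by (subst Bochner_Integration.integral_sum)
        (auto intro!: integrable_mult_right int sum.cong
          simp: q_def poly_sum poly_monom \<mu>_def integral_mult_right_zero mult_ac simp del: of_real_mult of_real_power)
  qed
  have scaled: "norm (of_real (g x) * z) \<le> R" if "norm z \<le> R" "x \<in> space M" for x and z :: complex
    using mult_right_mono[OF g1'[OF that(2)] norm_ge_zero[of z]] that(1) by (simp add: norm_mult)
  have T_mult: "norm (of_real (chebyshev_T k x) * u) \<le> norm u" if "x \<in> space M" for x and u :: complex
    using mult_right_mono[OF T1[OF that] norm_ge_zero[of u]] by (simp add: norm_mult)
  have "norm (poly q z) \<le> 2 * (cosh (Im z) + \<eta>)" if z: "norm z \<le> R" for z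
    unfolding q
  proof (rule bound)
    fix x assume x: "x \<in> space M"
    let ?w = "of_real (g x) * z"
    have "cosh (Im ?w) \<le> cosh (Im z)"
    proof -
      have "\<bar>Im ?w\<bar> \<le> \<bar>Im z\<bar>"
        using mult_right_mono[OF g1'[OF x] abs_ge_zero[of "Im z"]] by (simp add: abs_mult)
      then show ?thesis
        using cosh_le_cosh_of_abs_le[of "Im ?w" "\<bar>Im z\<bar>"] by simp
    qed
    then have "norm (S ?w) \<le> cosh (Im z) + \<eta>"
      using norm_triangle_ineq2[of "S ?w" "\<phi> ?w"] K[OF scaled[OF z x]] \<phi>[of ?w]
      by (simp add: S_def norm_minus_commute)
    then show "norm (of_real (chebyshev_T k x) * S ?w) \<le> cosh (Im z) + \<eta>"
      using T_mult[OF x] order_trans by blast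
  qed (use \<eta> cosh_real_pos[of "Im z"] in simp)
  moreover have "norm (of_real (LINT x:{-1..1}|lebesgue. chebyshev_T k x * \<psi> (Re z * g x)) - poly q z) \<le> 2 * \<eta>"
    if z: "norm z \<le> R" "Im z = 0" for z
  proof -
    let ?G = "\<lambda>x. of_real (chebyshev_T k x) * \<phi> (of_real (g x) * z)"
    have zr: "z = of_real (Re z)" using z(2) by (simp add: complex_eq_iff)
    have G: "?G x = of_real (chebyshev_T k x * \<psi> (Re z * g x))" for x
    proof -
      have "of_real (g x) * z = of_real (Re z * g x)" by (subst zr) simp
      then show ?thesis by (simp only: of_real_mult[of "chebyshev_T k x"] \<psi>(1))
    qed
    have [measurable]: "\<psi> \<in> borel_measurable borel"
      using \<psi>(2) by (rule borel_measurable_continuous_onI)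
    have "?G \<in> borel_measurable M" unfolding G by measurable
    moreover have "norm (?G x) \<le> 1" if "x \<in> space M" for x
      using T_mult[OF that, of "\<phi> (of_real (g x) * z)"] \<phi>[of "of_real (g x) * z"] z(2) by simp
    ultimately have Gint: "integrable M ?G"
      by (intro integrable_const_bound[of _ 1] AE_I2)
    have "(LINT x:{-1..1}|lebesgue. chebyshev_T k x * \<psi> (Re z * g x)) =
        (LINT x|M. chebyshev_T k x * \<psi> (Re z * g x))"
      by (simp add: M_def integral_restrict_space set_lebesgue_integral_def)
    then have "of_real (LINT x:{-1..1}|lebesgue. chebyshev_T k x * \<psi> (Re z * g x)) - poly q z =
        (LINT x|M. ?G x - of_real (chebyshev_T k x) * S (of_real (g x) * z))"
      unfolding q using Bochner_Integration.integral_diff[OF Gint qint[of z]] by (simp add: G del: of_real_mult)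
    also have "norm \<dots> \<le> 2 * \<eta>"
    proof (rule bound)
      fix x assume x: "x \<in> space M"
      have "norm (\<phi> (of_real (g x) * z) - S (of_real (g x) * z)) \<le> \<eta>"
        using K[OF scaled[OF z(1) x]] by (simp add: S_def)
      then show "norm (?G x - of_real (chebyshev_T k x) * S (of_real (g x) * z)) \<le> \<eta>"
        using T_mult[OF x] order_trans by (metis right_diff_distrib)
    qed (use \<eta> in simp)
    finally show ?thesis .
  qed
  ultimately show ?thesis by blast
qed

section \<open>Choice of the ellipse\<close>

lemma rank_const_eq: "rank_const = (exp 1 - exp (-1)) / 4"
proof -
  have "(exp 1 + inverse (exp (1::real)))\<^sup>2 - 4 = (exp 1 - exp (-1))\<^sup>2"
    by (simp add: power2_eq_square algebra_simps exp_minus)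
  then show ?thesis by (simp add: rank_const_def real_sqrt_unique)
qed

lemma Im_Joukowski:
  assumes "norm w = \<rho>" "\<rho> > 1"
  shows "\<bar>Im ((w + inverse w) / 2)\<bar> \<le> (\<rho> - 1 / \<rho>) / 2"
proof -
  have n: "(Re w)\<^sup>2 + (Im w)\<^sup>2 = \<rho>\<^sup>2" using assms(1) cmod_power2[of w] by simp
  have "Im ((w + inverse w) / 2) = Im w * (1 - 1 / \<rho>\<^sup>2) / 2"
    by (simp add: n right_diff_distrib)
  also have "\<bar>\<dots>\<bar> = \<bar>Im w\<bar> * ((1 - 1 / \<rho>\<^sup>2) / 2)"
    using assms(2) by (simp add: abs_mult)
  also have "\<dots> \<le> \<rho> * ((1 - 1 / \<rho>\<^sup>2) / 2)"
    using abs_Im_le_cmod[of w] assms by (intro mult_right_mono) auto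
  also have "\<dots> = (\<rho> - 1 / \<rho>) / 2"
    using assms(2) by (simp add: field_simps power2_eq_square)
  finally show ?thesis .
qed

lemma norm_Joukowski:
  fixes w :: complex
  assumes "norm w = \<rho>" "\<rho> > 1"
  shows "norm ((w + inverse w) / 2) \<le> \<rho>"
proof -
  have "norm (inverse w) \<le> \<rho>"
    using assms inverse_le_1_iff[of \<rho>] by (simp add: norm_inverse)
  then show ?thesis using norm_triangle_ineq[of w "inverse w"] assms by (simp add: norm_divide)
qed

text \<open>The premise on \<open>N\<close> says that \<open>N\<close> is not below the integer part of the allowed degree, so that
  \<open>8 e\<^sup>y / ((e - 1) e\<^sup>N e) < \<epsilon>\<close>. For \<open>\<rho> = e\<close> the error is \<open>4 cosh y / (e\<^sup>N (e - 1))\<close>, so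
  what is needed is \<open>cosh y \<le> (2/e) e\<^sup>y\<close>. This fails at \<open>y = 0\<close>, but holds from about
  \<open>y = 0.38\<close> on. For smaller \<open>y\<close> the growth of \<open>F\<close> is negligible even on a larger ellipse, where
  \<open>\<rho>\<^sup>N (\<rho> - 1)\<close> gains more than the missing factor.\<close>

lemma exists_good_ellipse:
  fixes h \<epsilon> :: real and N :: nat
  defines "y \<equiv> h * (exp 1 - exp (-1)) / 2"
  assumes h: "h > 0" and \<epsilon>: "0 < \<epsilon>" and N: "N \<ge> 1"
    and floor: "ln (8 / (exp 1 - 1)) + y + ln (1 / \<epsilon>) < real N + 1"
  shows "\<exists>\<rho>>1. 4 * cosh (h * (\<rho> - 1 / \<rho>) / 2) / (\<rho> ^ N * (\<rho> - 1)) < \<epsilon>"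
proof -
  define E :: real where "E = exp 1"
  have E: "E > 2.7" "E < 2.72"
    using e_approx_32 by (auto simp: E_def abs_if split: if_splits)
  have eps: "8 / (E - 1) * exp y / (exp (real N) * E) < \<epsilon>"
  proof -
    have "exp (ln (8 / (exp 1 - 1)) + y + ln (1 / \<epsilon>)) < exp (real N + 1)"
      using floor by simp
    then have "8 / (E - 1) * exp y * (1 / \<epsilon>) < exp (real N) * E"
      using \<epsilon> E by (simp add: exp_add E_def)
    then show ?thesis using \<epsilon> E by (simp add: field_simps)
  qed
  show ?thesis
  proof (cases "y \<ge> 1 / 2")
    case True
    have ym: "h * (E - 1 / E) / 2 = y" by (simp add: y_def E_def exp_minus inverse_eq_divide)
    have "exp (- y) \<le> exp (y - 1)" using True by simp
    then have "cosh y \<le> exp y * (1 + 1 / E) / 2"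
      by (simp add: cosh_field_def exp_diff E_def distrib_left add_divide_distrib)
    also have "\<dots> < exp y * (2 / E)"
      using E by (simp add: field_simps)
    finally have "4 * cosh y / (exp (real N) * (E - 1)) < 4 * (exp y * (2 / E)) / (exp (real N) * (E - 1))"
      using E by (intro divide_strict_right_mono mult_strict_left_mono) auto
    also have "\<dots> = 8 / (E - 1) * exp y / (exp (real N) * E)" by simp
    also note eps
    finally show ?thesis
      using E ym by (intro exI[of _ E]) (simp add: E_def flip: exp_of_nat_mult)
  next
    case False
    have "1 / E \<le> 0.371" using E by (simp add: field_simps)
    then have "h * 1.16 \<le> h * ((E - 1 / E) / 2)" using E h by (intro mult_left_mono) auto
    then have hy: "h * 1.16 \<le> y" by (simp add: y_def E_def exp_minus inverse_eq_divide)
    have "h * (4 - 1 / 4) / 2 \<le> y + 1 / 2" using hy False by simp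
    moreover have "cosh x \<le> exp x" if "x \<ge> 0" for x :: real
      using that by (simp add: cosh_field_def)
    from this[of "h * (4 - 1 / 4) / 2"] have "cosh (h * (4 - 1 / 4) / 2) \<le> exp (h * (4 - 1 / 4) / 2)"
      using h by simp
    ultimately have "cosh (h * (4 - 1 / 4) / 2) \<le> exp (y + 1 / 2)"
      by (rule order_trans[OF _ iffD2[OF exp_le_cancel_iff], rotated])
    also have "\<dots> \<le> exp y * 1.65"
    proof -
      have "(exp (1 / 2 :: real))\<^sup>2 \<le> 1.65\<^sup>2"
        using E by (simp add: E_def power2_eq_square flip: exp_add)
      then have "exp (1 / 2 :: real) \<le> 1.65" by (rule power2_le_imp_le) simp
      then show ?thesis by (simp add: exp_add)
    qed
    finally have c: "cosh (h * (4 - 1 / 4) / 2) \<le> exp y * 1.65" .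
    \<comment> \<open>The smallest \<open>N\<close>, namely 1, is the worst case for replacing \<open>4\<^sup>N\<close> by \<open>e\<^sup>N\<close>.\<close>
    have pow: "exp (real N) * 4 \<le> 4 ^ N * E"
    proof -
      obtain m where m: "N = Suc m" using N by (cases N) auto
      have "E ^ m \<le> 4 ^ m" using E by (intro power_mono) auto
      moreover have "exp (real N) = E ^ N" by (simp add: E_def flip: exp_of_nat_mult)
      ultimately show ?thesis using E m by (simp add: mult_ac)
    qed
    have "4 * cosh (h * (4 - 1 / 4) / 2) / (4 ^ N * (4 - 1)) \<le> 4 * (exp y * 1.65) / (4 ^ N * 3)"
      using c by (intro frac_le) auto
    also have "\<dots> \<le> 4 * (exp y * 1.65) / (exp (real N) * 4 / E * 3)"
      using pow E by (intro divide_left_mono mult_right_mono) (auto simp: field_simps)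
    also have "\<dots> = exp y / exp (real N) * (0.55 * E)"
      using E by (simp add: field_simps)
    also have "\<dots> \<le> exp y / exp (real N) * (8 / (E - 1) / E)"
    proof (rule mult_left_mono)
      have "(0.55 * E) * ((E - 1) * E) \<le> (0.55 * 2.72) * ((2.72 - 1) * 2.72)"
        using E by (intro mult_mono) auto
      then show "0.55 * E \<le> 8 / (E - 1) / E"
        using E by (simp add: pos_le_divide_eq algebra_simps)
    qed simp
    also have "\<dots> = 8 / (E - 1) * exp y / (exp (real N) * E)" by (simp add: mult_ac)
    also note eps
    finally show ?thesis by (intro exI[of _ 4]) simp
  qed
qed

section \<open>Polynomial approximation and the rank bound\<close>

text \<open>The strict inequality for \<open>\<epsilon>\<close> leaves room for the Taylor error \<open>\<eta>\<close>; the real part of the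
  complex approximant is at least as good, since \<open>F\<close> is real.\<close>

lemma osc_integral_real_poly_approx:
  fixes g F :: "real \<Rightarrow> real"
  assumes g: "g \<in> borel_measurable (lebesgue_on {-1..1})"
    and g1: "\<And>x. x \<in> {-1..1} \<Longrightarrow> \<bar>g x\<bar> \<le> 1"
    and F: "F = (\<lambda>\<omega>. osc_integral_Re g \<omega> (chebyshev_T k)) \<or>
            F = (\<lambda>\<omega>. osc_integral_Im g \<omega> (chebyshev_T k))"
    and h: "h > 0" and \<rho>: "\<rho> > 1"
    and \<epsilon>: "4 * cosh (h * (\<rho> - 1 / \<rho>) / 2) / (\<rho> ^ N * (\<rho> - 1)) < \<epsilon>"
  shows "\<exists>p :: real poly. degree p \<le> N \<and> (\<forall>t. \<bar>t\<bar> \<le> 1 \<longrightarrow> \<bar>F (c + h * t) - poly p t\<bar> \<le> \<epsilon>)"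
proof -
  define Y where "Y = h * (\<rho> - 1 / \<rho>) / 2"
  define D where "D = \<rho> ^ N * (\<rho> - 1)"
  have D: "D > 0" using \<rho> by (simp add: D_def)
  \<comment> \<open>The Taylor error enters twice: it raises the bound \<open>M\<close> on the ellipse, and it adds \<open>2 \<eta>\<close>.\<close>
  define \<eta> where "\<eta> = (\<epsilon> - 4 * cosh Y / D) / (4 / D + 2)"
  have \<eta>: "\<eta> > 0" using \<epsilon> D by (simp add: \<eta>_def Y_def D_def add_pos_pos)
  have total: "2 * (2 * (cosh Y + \<eta>)) / D + 2 * \<eta> = \<epsilon>"
  proof -
    have "4 / D + 2 > 0" using D by (simp add: add_pos_pos)
    then have "\<eta> * (4 / D + 2) = \<epsilon> - 4 * cosh Y / D" by (simp add: \<eta>_def)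
    then show ?thesis by (simp add: algebra_simps add_divide_distrib)
  qed
  \<comment> \<open>A disc that contains the ellipse after it is moved to the interval with centre \<open>c\<close>.\<close>
  define R where "R = \<bar>c\<bar> + h * \<rho>"
  have "\<exists>q :: complex poly. \<forall>z. norm z \<le> R \<longrightarrow>
      norm (poly q z) \<le> 2 * (cosh (Im z) + \<eta>) \<and>
      (Im z = 0 \<longrightarrow> norm (of_real (F (Re z)) - poly q z) \<le> 2 * \<eta>)"
    using F
  proof
    assume "F = (\<lambda>\<omega>. osc_integral_Re g \<omega> (chebyshev_T k))"
    then show ?thesis
      using osc_integral_poly_approx[OF g g1 cos_converges summable_norm_cos norm_sin_cos_le_cosh(1)
          cos_of_real[symmetric] continuous_on_cos[OF continuous_on_id] \<eta>, of R k]
      by (simp add: osc_integral_Re_def)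
  next
    assume "F = (\<lambda>\<omega>. osc_integral_Im g \<omega> (chebyshev_T k))"
    then show ?thesis
      using osc_integral_poly_approx[OF g g1 sin_converges summable_norm_sin norm_sin_cos_le_cosh(2)
          sin_of_real[symmetric] continuous_on_sin[OF continuous_on_id] \<eta>, of R k]
      by (simp add: osc_integral_Im_def)
  qed
  then obtain q :: "complex poly" where
      q: "\<And>z. norm z \<le> R \<Longrightarrow> norm (poly q z) \<le> 2 * (cosh (Im z) + \<eta>)"
    and qF: "\<And>z. norm z \<le> R \<Longrightarrow> Im z = 0 \<Longrightarrow> norm (of_real (F (Re z)) - poly q z) \<le> 2 * \<eta>"
    by blast
  let ?q = "q \<circ>\<^sub>p [:of_real c, of_real h:]"
  have "norm (poly ?q ((w + inverse w) / 2)) \<le> 2 * (cosh Y + \<eta>)" if w: "norm w = \<rho>" for w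
  proof -
    let ?j = "(w + inverse w) / 2" let ?z = "of_real c + of_real h * ?j"
    have "norm ?z \<le> \<bar>c\<bar> + h * norm ?j"
      using norm_triangle_ineq[of "of_real c" "of_real h * ?j"] h by (simp add: norm_mult)
    also have "\<dots> \<le> R"
      unfolding R_def using norm_Joukowski[OF w \<rho>] h by (intro add_left_mono mult_left_mono) auto
    finally have "norm (poly q ?z) \<le> 2 * (cosh (Im ?z) + \<eta>)" by (rule q)
    also have "cosh (Im ?z) \<le> cosh Y"
    proof -
      have "Im ?z = h * Im ?j" by simp
      then have "\<bar>Im ?z\<bar> = h * \<bar>Im ?j\<bar>" using h by (simp only: abs_mult abs_of_pos)
      also have "\<dots> \<le> h * ((\<rho> - 1 / \<rho>) / 2)"
        using Im_Joukowski[OF w \<rho>] h by (intro mult_left_mono) auto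
      finally have "\<bar>Im ?z\<bar> \<le> Y" by (simp add: Y_def)
      then show ?thesis by (rule cosh_le_cosh_of_abs_le)
    qed
    finally show ?thesis by (simp add: poly_pcompose mult.commute)
  qed
  from chebyshev_truncation[OF \<rho> this, of N] obtain p where p: "degree p \<le> N"
    "\<And>t. \<bar>t\<bar> \<le> 1 \<Longrightarrow> norm (poly ?q (of_real t) - poly p (of_real t)) \<le> 2 * (2 * (cosh Y + \<eta>)) / D"
    unfolding D_def by blast
  have Re_p: "poly (map_poly Re p) t = Re (poly p (of_real t))" for t
    by (induction p) (simp_all add: map_poly_pCons)
  have "\<bar>F (c + h * t) - poly (map_poly Re p) t\<bar> \<le> \<epsilon>" if t: "\<bar>t\<bar> \<le> 1" for t
  proof -
    let ?z = "of_real (c + h * t) :: complex"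
    have "norm ?z \<le> \<bar>c\<bar> + h * \<bar>t\<bar>"
      using abs_triangle_ineq[of c "h * t"] h by (simp only: norm_of_real abs_mult abs_of_pos)
    also have "\<dots> \<le> R" unfolding R_def using t h \<rho> by (intro add_left_mono mult_left_mono) auto
    finally have "norm (of_real (F (c + h * t)) - poly q ?z) \<le> 2 * \<eta>"
      using qF[of ?z] by simp
    moreover have "poly ?q (of_real t) = poly q ?z" by (simp add: poly_pcompose mult.commute)
    ultimately have "norm (of_real (F (c + h * t)) - poly p (of_real t)) \<le> \<epsilon>"
      using p(2)[OF t] total norm_triangle_ineq[of "of_real (F (c + h * t)) - poly q ?z" "poly q ?z - poly p (of_real t)"]
      by simp
    then show ?thesis
      using abs_Re_le_cmod[of "of_real (F (c + h * t)) - poly p (of_real t)"] by (simp add: Re_p)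
  qed
  moreover have "degree (map_poly Re p) \<le> N"
    using p(1) map_poly_degree_leq order_trans by blast
  ultimately show ?thesis by blast
qed

text \<open>The largest integer degree \<open>N\<close> allowed by the rank bound is used. It is at least 1, because
  \<open>ln (8 / (e - 1)) > 1\<close>.\<close>

theorem theorem4p4:
  fixes g F :: "real \<Rightarrow> real" and k L :: nat and \<omega>min \<omega>max \<epsilon> :: real
  assumes "g \<in> borel_measurable (lebesgue_on {-1..1})"
    and "\<And>x. x \<in> {-1..1} \<Longrightarrow> \<bar>g x\<bar> \<le> 1"
    and "F = (\<lambda>\<omega>. osc_integral_Re g \<omega> (chebyshev_T k)) \<or>
         F = (\<lambda>\<omega>. osc_integral_Im g \<omega> (chebyshev_T k))"
    and "\<omega>min < \<omega>max"
    and "L \<ge> 1"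
    and "0 < \<epsilon>" and "\<epsilon> < 1"
  shows "\<exists>\<nu>QTT r A. QTT_representation L r A \<nu>QTT \<and>
           (\<forall>l\<le>L. real (r l) \<le>
              1 + ln (8 / (exp 1 - 1)) + rank_const * (\<omega>max - \<omega>min) + ln (1 / \<epsilon>)) \<and>
           (\<forall>i<2 ^ L. \<bar>F (grid_point \<omega>min \<omega>max L i) - \<nu>QTT i\<bar> \<le> \<epsilon>)"
proof -
  define h where "h = (\<omega>max - \<omega>min) / 2"
  define c where "c = (\<omega>max + \<omega>min) / 2"
  define Q where "Q = ln (8 / (exp 1 - 1)) + rank_const * (\<omega>max - \<omega>min) + ln (1 / \<epsilon>)"
  define N where "N = nat \<lfloor>Q\<rfloor>"
  have h: "h > 0" using assms(4) by (simp add: h_def)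
  have y: "rank_const * (\<omega>max - \<omega>min) = h * (exp 1 - exp (- 1)) / 2"
    by (simp add: rank_const_eq h_def)
  have "Q \<ge> 1"
  proof -
    have "exp 1 * (exp 1 - 1) \<le> (2.72 * 1.72 :: real)"
      using e_approx_32 by (intro mult_mono) (auto simp: abs_if split: if_splits)
    then have "exp 1 \<le> 8 / (exp 1 - 1 :: real)"
      by (simp add: pos_le_divide_eq)
    then have "1 \<le> ln (8 / (exp 1 - 1 :: real))"
      by (simp add: ln_ge_iff)
    moreover have "rank_const * (\<omega>max - \<omega>min) \<ge> 0"
      unfolding y using h by simp
    moreover have "ln (1 / \<epsilon>) \<ge> 0" using assms(6,7) by simp
    ultimately show ?thesis by (simp add: Q_def)
  qed
  then have N: "N \<ge> 1" "real N \<le> Q" "Q < real N + 1"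
    by (auto simp: N_def le_nat_floor)
  obtain \<rho> where \<rho>: "\<rho> > 1" "4 * cosh (h * (\<rho> - 1 / \<rho>) / 2) / (\<rho> ^ N * (\<rho> - 1)) < \<epsilon>"
    using exists_good_ellipse[OF h assms(6) N(1)] N(3) unfolding Q_def y by blast
  obtain p where p: "degree p \<le> N" "\<And>t. \<bar>t\<bar> \<le> 1 \<Longrightarrow> \<bar>F (c + h * t) - poly p t\<bar> \<le> \<epsilon>"
    using osc_integral_real_poly_approx[OF assms(1-3) h \<rho>] by metis
  define t where "t = (\<lambda>i. -1 + 2 / (2 ^ L - 1) * i :: real)"
  define P where "P = p \<circ>\<^sub>p [:-1, 2 / (2 ^ L - 1):]"
  have P: "poly P (real i) = poly p (t i)" for i :: nat
    by (simp add: P_def t_def poly_pcompose mult.commute)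
  have "degree P \<le> N"
    using degree_pcompose_le[of p "[:-1, 2 / (2 ^ L - 1):]"] p(1)
    by (auto simp: P_def split: if_splits)
  from polynomial_QTT_representation[OF assms(5) this] obtain A where
    A: "QTT_representation L (\<lambda>l. if l = 0 \<or> l = L then 1 else N + 1) A (\<lambda>i. poly P (real i))" ..
  have L2: "(2::real) ^ L - 1 > 0"
    using assms(5) one_less_power[of "2::real" L] by simp
  have "\<bar>F (grid_point \<omega>min \<omega>max L i) - poly P (real i)\<bar> \<le> \<epsilon>" if i: "i < 2 ^ L" for i
  proof -
    have "real i \<le> 2 ^ L - 1"
    proof -
      have "real (i + 1) \<le> real (2 ^ L)" using i by (intro of_nat_mono) simp
      then show ?thesis by simp
    qed
    then have "real i / (2 ^ L - 1) \<le> 1" "real i / (2 ^ L - 1) \<ge> 0" using L2 by auto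
    then have "\<bar>t i\<bar> \<le> 1" by (simp add: t_def abs_le_iff)
    moreover have "grid_point \<omega>min \<omega>max L i = c + h * t i"
      by (simp add: grid_point_def c_def h_def t_def field_simps)
    ultimately show ?thesis using p(2) by (simp add: P)
  qed
  moreover have "real (if l = 0 \<or> l = L then 1 else N + 1) \<le>
      1 + ln (8 / (exp 1 - 1)) + rank_const * (\<omega>max - \<omega>min) + ln (1 / \<epsilon>)" for l
    using N(2) \<open>Q \<ge> 1\<close> by (simp add: Q_def)
  ultimately show ?thesis using A by blast
qed

end
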